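(* Let $A, E, F\in\mathbb{C}^{n\times n}$ with $E$ and $F$ invertible and Hermitian. If there exist $X,Y\in\mathbb{C}^{n\times n}$ such that $AXA=A=AYA$, $(EAX)^*=EAX$ and $(FYA)^*=FYA$, then the generalized weighted Moore-Penrose inverse $A^{\dagger}_{E,F}$ exists and $A^{\dagger}_{E,F}=YAX$.
   Context: The generalized weighted Moore-Penrose inverse $A^\dagger_{E,F}$ is the matrix $Z$, unique when it exists, with $AZA=A$, $ZAZ=Z$, $(EAZ)^*=EAZ$, $(FZA)^*=FZA$. *)

theory Defs
  imports Complex_Main "Jordan_Normal_Form.Schur_Decomposition"
begin

definition hermitian_mat :: "complex mat \<Rightarrow> bool"
  where "hermitian_mat H \<longleftrightarrow> mat_adjoint H = H"

text \<open>The dimension \<open>n\<close> is an explicit argument because the type \<open>complex mat\<close> contains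
  matrices of all sizes, and uniqueness is meant among the \<open>n\<close> by \<open>n\<close> matrices.\<close>

definition is_gen_weighted_MP_inverse ::
  "nat \<Rightarrow> complex mat \<Rightarrow> complex mat \<Rightarrow> complex mat \<Rightarrow> complex mat \<Rightarrow> bool"
  where "is_gen_weighted_MP_inverse n E F A Z \<longleftrightarrow>
    Z \<in> carrier_mat n n \<and>
    A * Z * A = A \<and>
    Z * A * Z = Z \<and>
    mat_adjoint (E * A * Z) = E * A * Z \<and>
    mat_adjoint (F * Z * A) = F * Z * A"

text \<open>A meaningful value only when exactly one matrix satisfies the four equations; existence
  of the inverse is therefore expressed by unique existence in addition to its value.\<close>

definition gen_weighted_MP_inverse ::
  "nat \<Rightarrow> complex mat \<Rightarrow> complex mat \<Rightarrow> complex mat \<Rightarrow> complex mat"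
  where "gen_weighted_MP_inverse n E F A = (THE Z. is_gen_weighted_MP_inverse n E F A Z)"

end

theory Submission
  imports Defs
begin

text \<open>If \<open>E\<close>, \<open>E P\<close> and \<open>E Q\<close> are Hermitian, then the adjoint of \<open>E P Q\<close> is \<open>E Q P\<close>. Hence, for
  invertible \<open>E\<close>, such idempotents \<open>P\<close> and \<open>Q\<close> agree as soon as they have the same range or the same
  kernel. For any weighted inverse \<open>Z\<close> this gives \<open>A Z = A X\<close> and \<open>Z A = Y A\<close>, so that
  \<open>Z = Z A Z = Y A X\<close>.\<close>

lemma mat_adjoint_carrier:
  assumes "A \<in> carrier_mat n m"
  shows "mat_adjoint A \<in> carrier_mat m n"
  using assms unfolding mat_adjoint_def by auto

lemma mat_adjoint_mult:
  fixes A B :: "complex mat"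
  assumes A: "A \<in> carrier_mat n m" and B: "B \<in> carrier_mat m k"
  shows "mat_adjoint (A * B) = mat_adjoint B * mat_adjoint A"
proof (rule eq_matI)
  fix i j
  assume "i < dim_row (mat_adjoint B * mat_adjoint A)"
    and "j < dim_col (mat_adjoint B * mat_adjoint A)"
  then have i: "i < k" and j: "j < n"
    using mat_adjoint_carrier[OF A] mat_adjoint_carrier[OF B] by auto
  show "mat_adjoint (A * B) $$ (i, j) = (mat_adjoint B * mat_adjoint A) $$ (i, j)"
    using A B i j
    by (simp add: mat_adjoint_def scalar_prod_def mat_of_rows_index mult.commute)
qed (use A B in \<open>auto simp: mat_adjoint_def\<close>)

lemma invertible_mat_mult_left_cancel:
  fixes E :: "'a :: semiring_1 mat"
  assumes E: "E \<in> carrier_mat n n" and inv: "invertible_mat E"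
    and B: "B \<in> carrier_mat n m" and C: "C \<in> carrier_mat n m"
    and eq: "E * B = E * C"
  shows "B = C"
proof -
  obtain G where EG: "E * G = 1\<^sub>m (dim_row E)" and GE: "G * E = 1\<^sub>m (dim_row G)"
    using inv unfolding invertible_mat_def inverts_mat_def by blast
  \<comment> \<open>\<open>invertible_mat\<close> does not fix the size of the inverse. Comparing
    column counts in \<open>G * E = 1\<close> and \<open>E * G = 1\<close> shows that
    \<open>G\<close> is square of size \<open>n\<close>.\<close>
  have "dim_row G = n"
    using arg_cong[OF GE, of dim_col] carrier_matD(2)[OF E] by (metis index_mult_mat(3) index_one_mat(3))
  moreover have "dim_col G = n"
    using arg_cong[OF EG, of dim_col] carrier_matD(1)[OF E] by (metis index_mult_mat(3) index_one_mat(3))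
  ultimately have G: "G \<in> carrier_mat n n" and GE: "G * E = 1\<^sub>m n"
    using GE by (blast, metis)
  have "B = G * (E * B)"
    by (metis assoc_mult_mat[OF G E B] GE left_mult_one_mat[OF B])
  also have "\<dots> = G * (E * C)"
    by (rule arg_cong[OF eq])
  also have "\<dots> = C"
    by (metis assoc_mult_mat[OF G E C] GE left_mult_one_mat[OF C])
  finally show ?thesis .
qed

text \<open>\<open>P\<close> and \<open>Q\<close> are self-adjoint for the sesquilinear form given
  by \<open>E\<close>, so taking the adjoint reverses their product.\<close>

lemma mat_adjoint_weighted_mult:
  assumes E: "E \<in> carrier_mat n n" and P: "P \<in> carrier_mat n n" and Q: "Q \<in> carrier_mat n n"
    and hE: "hermitian_mat E"
    and hP: "mat_adjoint (E * P) = E * P" and hQ: "mat_adjoint (E * Q) = E * Q"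
  shows "mat_adjoint (E * (P * Q)) = E * (Q * P)"
proof -
  note c = E P Q mat_adjoint_carrier[OF P] mat_adjoint_carrier[OF Q]
  have aE: "mat_adjoint E = E" using hE by (simp add: hermitian_mat_def)
  \<comment> \<open>Since \<open>E\<close> is its own adjoint, the left side is the adjoint of
    \<open>E * P\<close>. This is what lets \<open>E\<close> move past an adjoint factor.\<close>
  have P': "mat_adjoint P * E = E * P" and Q': "mat_adjoint Q * E = E * Q"
    using hP hQ mat_adjoint_mult[OF E P] mat_adjoint_mult[OF E Q] aE by auto
  have "mat_adjoint (E * (P * Q)) = mat_adjoint ((E * P) * Q)"
    using c by (simp add: assoc_mult_mat[of _ n n _ n _ n])
  also have "\<dots> = mat_adjoint Q * (E * P)"
    using mat_adjoint_mult[of "E * P" n n Q n] c hP by auto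
  also have "\<dots> = (mat_adjoint Q * E) * P"
    using c by (simp add: assoc_mult_mat[of _ n n _ n _ n])
  also have "\<dots> = E * (Q * P)"
    unfolding Q' using c by (simp add: assoc_mult_mat[of _ n n _ n _ n])
  finally show ?thesis .
qed

text \<open>The last two hypotheses make \<open>P\<close> and \<open>Q\<close> idempotents with a
  common range. The adjoint of \<open>E * (P * Q)\<close> is \<open>E * Q\<close> by
  \<open>hQ\<close>, and \<open>E * P\<close> by reversing the product; then \<open>E\<close>
  cancels.\<close>

lemma weighted_projection_unique_range:
  assumes E: "E \<in> carrier_mat n n" and P: "P \<in> carrier_mat n n" and Q: "Q \<in> carrier_mat n n"
    and inv: "invertible_mat E" and hE: "hermitian_mat E"
    and hP: "mat_adjoint (E * P) = E * P" and hQ: "mat_adjoint (E * Q) = E * Q"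
    and QP: "Q * P = P" and PQ: "P * Q = Q"
  shows "P = Q"
proof (rule invertible_mat_mult_left_cancel[OF E inv P Q])
  show "E * P = E * Q"
    using mat_adjoint_weighted_mult[OF E P Q hE hP hQ] unfolding QP PQ hQ by simp
qed

text \<open>Here the idempotents share their kernel, so \<open>P * Q\<close> collapses to
  \<open>P\<close> instead and \<open>hP\<close> takes the place of \<open>hQ\<close>.\<close>

lemma weighted_projection_unique_kernel:
  assumes E: "E \<in> carrier_mat n n" and P: "P \<in> carrier_mat n n" and Q: "Q \<in> carrier_mat n n"
    and inv: "invertible_mat E" and hE: "hermitian_mat E"
    and hP: "mat_adjoint (E * P) = E * P" and hQ: "mat_adjoint (E * Q) = E * Q"
    and PQ: "P * Q = P" and QP: "Q * P = Q"
  shows "P = Q"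
proof (rule invertible_mat_mult_left_cancel[OF E inv P Q])
  show "E * P = E * Q"
    using mat_adjoint_weighted_mult[OF E P Q hE hP hQ] unfolding QP PQ hP by simp
qed

theorem proposition3p32:
  fixes n :: nat and A E F X Y :: "complex mat"
  assumes "A \<in> carrier_mat n n" and "E \<in> carrier_mat n n" and "F \<in> carrier_mat n n"
    and "invertible_mat E" and "hermitian_mat E"
    and "invertible_mat F" and "hermitian_mat F"
    and "X \<in> carrier_mat n n" and "Y \<in> carrier_mat n n"
    and "A * X * A = A" and "A * Y * A = A"
    and "mat_adjoint (E * A * X) = E * A * X"
    and "mat_adjoint (F * Y * A) = F * Y * A"
  shows "(\<exists>!Z. is_gen_weighted_MP_inverse n E F A Z)
    \<and> gen_weighted_MP_inverse n E F A = Y * A * X"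
proof -
  note A = assms(1) and E = assms(2) and F = assms(3) and X = assms(8) and Y = assms(9)
  note AXA = assms(10) and AYA = assms(11)
  note assoc = assoc_mult_mat[of _ n n _ n _ n]
  have mult: "B * C \<in> carrier_mat n n"
    if "B \<in> carrier_mat n n" "C \<in> carrier_mat n n" for B C :: "complex mat"
    using that by auto
  \<comment> \<open>The equation \<open>A * B * A = A\<close> in right-nested form with a trailing
    factor, ready for rewriting once \<open>assoc\<close> has moved all parentheses to the
    right.\<close>
  have inner_absorb: "A * (B * (A * C)) = A * C"
    if "B \<in> carrier_mat n n" "C \<in> carrier_mat n n" "A * B * A = A" for B C
    using assoc[OF A that(1) mult[OF A that(2)]] assoc[OF mult[OF A that(1)] A that(2)] that(3)
    by simp
  have exist: "is_gen_weighted_MP_inverse n E F A (Y * A * X)"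
    unfolding is_gen_weighted_MP_inverse_def
  proof (intro conjI)
    \<comment> \<open>\<open>Y\<close> is absorbed on the left and \<open>X\<close> on the right, so
      each weighted symmetry condition reduces to the one assumed for \<open>X\<close> or for
      \<open>Y\<close>.\<close>
    have AZ: "A * (Y * A * X) = A * X" and ZA: "Y * A * X * A = Y * A"
      using A X Y AXA by (simp_all add: assoc mult inner_absorb[OF Y X AYA])
    show Z: "Y * A * X \<in> carrier_mat n n" using A X Y by (intro mult)
    show "A * (Y * A * X) * A = A" using AZ AXA by simp
    show "Y * A * X * A * (Y * A * X) = Y * A * X"
      unfolding ZA using A X Y by (simp add: assoc mult inner_absorb[OF Y X AYA])
    have EAZ: "E * A * (Y * A * X) = E * A * X"
      using AZ assoc[OF E A Z] assoc[OF E A X] by simp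
    show "mat_adjoint (E * A * (Y * A * X)) = E * A * (Y * A * X)"
      unfolding EAZ by (rule assms(12))
    have FZA: "F * (Y * A * X) * A = F * Y * A"
      using ZA assoc[OF F Z A] assoc[OF F Y A] by simp
    show "mat_adjoint (F * (Y * A * X) * A) = F * (Y * A * X) * A"
      unfolding FZA by (rule assms(13))
  qed
  have uniq: "Z = Y * A * X" if "is_gen_weighted_MP_inverse n E F A Z" for Z
  proof -
    have Z: "Z \<in> carrier_mat n n" and AZA: "A * Z * A = A" and ZAZ: "Z * A * Z = Z"
      and hEZ: "mat_adjoint (E * A * Z) = E * A * Z"
      and hFZ: "mat_adjoint (F * Z * A) = F * Z * A"
      using that unfolding is_gen_weighted_MP_inverse_def by auto
    \<comment> \<open>Both are projections onto the range of \<open>A\<close>, as \<open>Z\<close>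
      and \<open>X\<close> are inner inverses of \<open>A\<close>.\<close>
    have AZ: "A * Z = A * X"
    proof (rule weighted_projection_unique_range[OF E _ _ assms(4,5)])
      show "mat_adjoint (E * (A * Z)) = E * (A * Z)" using hEZ assoc[OF E A Z] by simp
      show "mat_adjoint (E * (A * X)) = E * (A * X)" using assms(12) assoc[OF E A X] by simp
      show "A * X * (A * Z) = A * Z"
        using A X Z by (simp add: assoc mult inner_absorb[OF X Z AXA])
      show "A * Z * (A * X) = A * X"
        using A X Z by (simp add: assoc mult inner_absorb[OF Z X AZA])
    qed (use A X Z in auto)
    \<comment> \<open>Dually, both are idempotents whose kernel is that of \<open>A\<close>, now
      with weight \<open>F\<close>.\<close>
    have ZA: "Z * A = Y * A"
    proof (rule weighted_projection_unique_kernel[OF F _ _ assms(6,7)])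
      show "mat_adjoint (F * (Z * A)) = F * (Z * A)" using hFZ assoc[OF F Z A] by simp
      show "mat_adjoint (F * (Y * A)) = F * (Y * A)" using assms(13) assoc[OF F Y A] by simp
      show "Z * A * (Y * A) = Z * A"
        using A Y Z AYA by (simp add: assoc mult)
      show "Y * A * (Z * A) = Y * A"
        using A Y Z AZA by (simp add: assoc mult)
    qed (use A Y Z in auto)
    have "Z = Y * (A * Z)" using ZAZ ZA assoc[OF Y A Z] by simp
    then show ?thesis using AZ assoc[OF Y A X] by simp
  qed
  have "gen_weighted_MP_inverse n E F A = Y * A * X"
    unfolding gen_weighted_MP_inverse_def using exist uniq by (rule the_equality)
  then show ?thesis using exist uniq by blast
qed

end
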